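(* Let $M\in\mathbb{F}_q[x]$ be a non-constant polynomial with $\gcd(b,M)=1$. Then: (a) $\beta(M)\mid 2\,\mathrm{ord}_M(-b)$; (b) $\pi(M)=\epsilon\cdot\mathrm{lcm}[\alpha(M),\mathrm{ord}_M(-b)]$ for some $\epsilon\in\{1,2\}$.
   Context: Let $\mathbb{F}_q$ be a finite field. Fix $a,b\in\mathbb{F}_q[x]$ with $b\neq 0$. The generalized Fibonacci sequence is $F_0=0$, $F_1=1$, $F_n=aF_{n-1}+bF_{n-2}$ for $n\ge 2$. For a non-constant $M\in\mathbb{F}_q[x]$ with $\gcd(b,M)=1$, the rank $\alpha(M)$ is the least positive integer $n$ with $F_n\equiv 0\pmod M$, the period $\pi(M)$ is the least positive integer $n$ with $F_n\equiv 0$ and $F_{n+1}\equiv 1\pmod M$, and $\beta(M)=\pi(M)/\alpha(M)$ (which is an integer). $\mathrm{ord}_M(-b)$ is the multiplicative order of $-b$ modulo $M$. *)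

theory Defs
  imports "HOL-Number_Theory.Number_Theory" "HOL-Computational_Algebra.Polynomial"
begin

fun fib_seq :: "'a::comm_semiring_1 \<Rightarrow> 'a \<Rightarrow> nat \<Rightarrow> 'a" where
  "fib_seq a b 0 = 0"
| "fib_seq a b (Suc 0) = 1"
| "fib_seq a b (Suc (Suc n)) = a * fib_seq a b (Suc n) + b * fib_seq a b n"

definition rank_mod :: "'a::field poly \<Rightarrow> 'a poly \<Rightarrow> 'a poly \<Rightarrow> nat" where
  "rank_mod a b M = (LEAST n. n > 0 \<and> [fib_seq a b n = 0] (mod M))"

definition period_mod :: "'a::field poly \<Rightarrow> 'a poly \<Rightarrow> 'a poly \<Rightarrow> nat" where
  "period_mod a b M =
     (LEAST n. n > 0 \<and> [fib_seq a b n = 0] (mod M) \<and> [fib_seq a b (Suc n) = 1] (mod M))"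

text \<open>
  The natural-number division is exact: the theorem \<open>rank_mod_dvd_period_mod\<close> below shows
  that \<^const>\<open>rank_mod\<close> divides \<^const>\<open>period_mod\<close> when \<open>b\<close> and \<open>M\<close> are coprime, \<open>M\<close> is
  non-constant and the coefficient field is finite.
\<close>
definition beta_mod :: "'a::field poly \<Rightarrow> 'a poly \<Rightarrow> 'a poly \<Rightarrow> nat" where
  "beta_mod a b M = period_mod a b M div rank_mod a b M"

text \<open>
  The library's cancellation rule for coprime divisors needs a gcd, which polynomials over an
  arbitrary field do not carry.
\<close>
lemma poly_bezout:
  fixes p q :: "'a::field poly"
  assumes "coprime p q"
  shows "\<exists>u v. u * p + v * q = 1"
  using assms
proof (induction "if q = 0 then 0 else Suc (degree q)" arbitrary: p q rule: less_induct)
  case less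
  show ?case
  proof (cases "q = 0")
    case True
    then have "p dvd 1" using less.prems by simp
    then obtain u where "1 = p * u" by (auto elim: dvdE)
    then show ?thesis by (intro exI[of _ u]) (simp add: True mult.commute)
  next
    case False
    have "coprime q (p mod q)"
    proof (rule coprimeI)
      fix d assume "d dvd q" "d dvd p mod q"
      then have "d dvd p" by (metis dvd_mod_imp_dvd)
      then show "is_unit d" using less.prems \<open>d dvd q\<close> coprime_common_divisor by blast
    qed
    moreover have "(if p mod q = 0 then 0 else Suc (degree (p mod q))) < (if q = 0 then 0 else Suc (degree q))"
      using False degree_mod_less[of q p] by auto
    ultimately obtain u v where "u * q + v * (p mod q) = 1" using less.hyps by blast
    then have "v * p + (u - v * (p div q)) * q = 1"
      by (simp add: minus_div_mult_eq_mod[symmetric] algebra_simps)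
    then show ?thesis by blast
  qed
qed

lemma poly_coprime_dvd_mult:
  fixes p q r :: "'a::field poly"
  assumes "coprime p q" "p dvd q * r"
  shows "p dvd r"
proof -
  obtain u v where "u * p + v * q = 1" using poly_bezout[OF assms(1)] by blast
  then have "r = (u * p + v * q) * r" by simp
  also have "\<dots> = p * (u * r) + v * (q * r)" by (simp add: algebra_simps)
  finally show ?thesis using assms(2) by (metis dvd_add dvd_mult dvd_triv_left)
qed

lemma finite_degree_less: "finite {p :: 'a::{field,finite} poly. degree p < k}"
proof -
  have "{p :: 'a poly. degree p < k} \<subseteq> Poly ` {xs. set xs \<subseteq> UNIV \<and> length xs \<le> k}"
  proof
    fix p :: "'a poly" assume "p \<in> {p. degree p < k}"
    then have "length (coeffs p) \<le> k"
      by (cases "p = 0") (auto simp: length_coeffs_degree)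
    then show "p \<in> Poly ` {xs. set xs \<subseteq> UNIV \<and> length xs \<le> k}"
      by (intro image_eqI[of _ _ "coeffs p"]) auto
  qed
  moreover have "finite {xs :: 'a list. set xs \<subseteq> UNIV \<and> length xs \<le> k}"
    by (rule finite_lists_length_le) simp
  ultimately show ?thesis using finite_surj by blast
qed

lemma fib_seq_cancel:
  fixes a b M :: "'a::field poly"
  assumes "coprime b M"
    and "[fib_seq a b i = fib_seq a b (i + n)] (mod M)"
    and "[fib_seq a b (Suc i) = fib_seq a b (Suc (i + n))] (mod M)"
  shows "[fib_seq a b n = 0] (mod M) \<and> [fib_seq a b (Suc n) = 1] (mod M)"
  using assms(2,3)
proof (induction i)
  case 0
  then show ?case by (simp add: cong_sym_eq)
next
  case (Suc i)
  let ?F = "fib_seq a b"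
  have 1: "M dvd ?F (Suc i) - ?F (Suc (i + n))"
    using Suc.prems(1) by (simp add: cong_iff_dvd_diff)
  have "M dvd ?F (Suc (Suc i)) - ?F (Suc (Suc (i + n)))"
    using Suc.prems(2) by (simp add: cong_iff_dvd_diff)
  from dvd_diff[OF this dvd_mult[OF 1, of a]]
  have "M dvd b * (?F i - ?F (i + n))" by (simp add: algebra_simps)
  then have "M dvd ?F i - ?F (i + n)"
    using assms(1) poly_coprime_dvd_mult coprime_commute by blast
  then show ?case using Suc 1 by (simp add: cong_iff_dvd_diff)
qed

lemma fib_seq_period_exists:
  fixes a b M :: "'a::{field,finite} poly"
  assumes "degree M > 0" "coprime b M"
  shows "\<exists>n>0. [fib_seq a b n = 0] (mod M) \<and> [fib_seq a b (Suc n) = 1] (mod M)"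
proof -
  let ?S = "{p :: 'a poly. degree p < degree M}"
  let ?g = "\<lambda>n. (fib_seq a b n mod M, fib_seq a b (Suc n) mod M)"
  have d: "degree (p mod M) < degree M" for p :: "'a poly"
    using assms(1) degree_mod_less[of M p] by (cases "M = 0") auto
  then have "range ?g \<subseteq> ?S \<times> ?S" by auto
  then have "finite (range ?g)"
    using finite_degree_less finite_subset by blast
  then have "\<not> inj ?g" using finite_imageD infinite_UNIV_nat by blast
  then obtain i j where "i < j" "?g i = ?g j"
    by (metis (no_types, lifting) injI linorder_neqE_nat)
  then have "[fib_seq a b i = fib_seq a b (i + (j - i))] (mod M)"
    "[fib_seq a b (Suc i) = fib_seq a b (Suc (i + (j - i)))] (mod M)"
    by (auto simp: cong_def)
  from fib_seq_cancel[OF assms(2) this] \<open>i < j\<close> show ?thesis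
    by (intro exI[of _ "j - i"]) auto
qed

lemma period_mod_spec:
  fixes a b M :: "'a::{field,finite} poly"
  assumes "degree M > 0" "coprime b M"
  shows "period_mod a b M > 0" "[fib_seq a b (period_mod a b M) = 0] (mod M)"
    "[fib_seq a b (Suc (period_mod a b M)) = 1] (mod M)"
  using LeastI_ex[OF fib_seq_period_exists[OF assms, of a]] by (auto simp: period_mod_def)

lemma rank_mod_spec:
  fixes a b M :: "'a::{field,finite} poly"
  assumes "degree M > 0" "coprime b M"
  shows "rank_mod a b M > 0" "[fib_seq a b (rank_mod a b M) = 0] (mod M)"
proof -
  have "\<exists>n>0. [fib_seq a b n = 0] (mod M)" using fib_seq_period_exists[OF assms, of a] by blast
  from LeastI_ex[OF this] show "rank_mod a b M > 0" "[fib_seq a b (rank_mod a b M) = 0] (mod M)"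
    by (auto simp: rank_mod_def)
qed

lemma fib_seq_add:
  "fib_seq a b (m + Suc n) = fib_seq a b (Suc m) * fib_seq a b (Suc n) + b * fib_seq a b m * fib_seq a b n"
proof (induction m arbitrary: n)
  case (Suc m)
  have "fib_seq a b (Suc m + Suc n) = fib_seq a b (m + Suc (Suc n))" by simp
  also have "\<dots> = fib_seq a b (Suc m) * fib_seq a b (Suc (Suc n)) + b * fib_seq a b m * fib_seq a b (Suc n)"
    by (rule Suc.IH)
  finally show ?case by (simp add: algebra_simps)
qed simp

lemma fib_seq_consecutive_dvd:
  fixes a b d :: "'a::field poly"
  assumes "coprime b d" "d dvd fib_seq a b m" "d dvd fib_seq a b (Suc m)"
  shows "d dvd 1"
  using assms(2,3)
proof (induction m)
  case (Suc m)
  from Suc.prems have "d dvd b * fib_seq a b m"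
    by (simp add: dvd_add_right_iff)
  then have "d dvd fib_seq a b m"
    using assms(1) poly_coprime_dvd_mult coprime_commute by blast
  with Suc show ?case by blast
qed simp

lemma rank_mod_dvd:
  fixes a b M :: "'a::{field,finite} poly"
  assumes "degree M > 0" "coprime b M" "[fib_seq a b n = 0] (mod M)"
  shows "rank_mod a b M dvd n"
  using assms(3)
proof (induction n rule: less_induct)
  case (less n)
  let ?r = "rank_mod a b M"
  note r = rank_mod_spec[OF assms(1,2), of a]
  show ?case
  proof (cases "n = 0 \<or> n = ?r")
    case False
    have "n > 0" using False by simp
    have "\<not> n < ?r"
    proof
      assume "n < ?r"
      from not_less_Least[OF this[unfolded rank_mod_def]] \<open>n > 0\<close> less.prems
      show False by blast
    qed
    then obtain k where k: "n = ?r + Suc k" using False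
      by (intro that[of "n - Suc ?r"]) auto
    have M: "M dvd fib_seq a b ?r" using r(2) by (simp add: cong_0_iff)
    have "M dvd fib_seq a b (Suc ?r) * fib_seq a b (Suc k) + b * fib_seq a b ?r * fib_seq a b k"
      using less.prems by (simp only: k fib_seq_add cong_0_iff)
    then have *: "M dvd fib_seq a b (Suc ?r) * fib_seq a b (Suc k)"
      by (simp only: dvd_add_left_iff[OF dvd_mult2[OF dvd_mult[OF M]]])
    have "coprime M (fib_seq a b (Suc ?r))"
    proof (rule coprimeI)
      fix d assume d: "d dvd M" "d dvd fib_seq a b (Suc ?r)"
      have "coprime b d" by (rule coprime_divisors[OF dvd_refl d(1) assms(2)])
      then show "is_unit d" by (rule fib_seq_consecutive_dvd[OF _ dvd_trans[OF d(1) M] d(2)])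
    qed
    from this * have "[fib_seq a b (Suc k) = 0] (mod M)"
      unfolding cong_0_iff by (rule poly_coprime_dvd_mult)
    moreover have "Suc k < n" using k r(1) by linarith
    ultimately have "?r dvd Suc k" using less.IH by blast
    then show ?thesis unfolding k by (rule dvd_add[OF dvd_refl])
  qed auto
qed

theorem rank_mod_dvd_period_mod:
  fixes a b M :: "'a::{field,finite} poly"
  assumes "degree M > 0" "coprime b M"
  shows "rank_mod a b M dvd period_mod a b M"
  using rank_mod_dvd[OF assms] period_mod_spec(2)[OF assms] by blast

end

theory Submission
  imports Defs
begin

text \<open>
  Write \<open>F n\<close> for \<open>fib_seq a b n\<close>, \<open>r\<close> for the rank, \<open>p\<close> for the period, \<open>o\<close> for the order
  of \<open>-b\<close> modulo \<open>M\<close>, and \<open>L = lcm r o\<close>. Everything rests on Cassini's identity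
  \<open>F (n+1)\<^sup>2 - a F (n+1) F n - b (F n)\<^sup>2 = (-b)^n\<close> (lemma \<open>fib_seq_cassini\<close>): at an index \<open>n\<close>
  where \<open>F n\<close> vanishes modulo \<open>M\<close>, it ties the multiplier \<open>F (n+1)\<close>, by which the sequence is
  scaled when shifted by \<open>n\<close>, to a power of \<open>-b\<close>, but only up to its square. This square is
  the source of the factor two.

  At \<open>n = p\<close> the multiplier is \<open>1\<close>, so \<open>(-b)^p = 1\<close> and hence \<open>o\<close> divides \<open>p\<close>; as \<open>r\<close>
  divides \<open>p\<close> too, \<open>L\<close> divides \<open>p\<close>. Conversely, at \<open>n = L\<close> the sequence vanishes because \<open>r\<close>
  divides \<open>L\<close>, and the square of the multiplier is \<open>(-b)^L = 1\<close>. Shifting by \<open>L\<close> twice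
  therefore restores the initial values \<open>0, 1\<close>, so \<open>p\<close> divides \<open>2 L\<close>. From \<open>L dvd p\<close> and
  \<open>p dvd 2 L\<close> the quotient \<open>p / L\<close> is \<open>1\<close> or \<open>2\<close>. Finally \<open>L\<close> divides \<open>r o\<close>, so \<open>p\<close> divides
  \<open>r (2 o)\<close>, and cancelling \<open>r\<close> gives the claim on \<open>p / r\<close>.
\<close>

text \<open>
  The left-hand side is the norm form of \<open>T\<^sup>2 - a T - b\<close>, and the shift
  \<open>(F n, F (n+1)) \<mapsto> (F (n+1), F (n+2))\<close> multiplies it by the determinant \<open>-b\<close> of the
  companion matrix.
\<close>
lemma fib_seq_cassini:
  fixes a b :: "'a::comm_ring_1"
  shows "(fib_seq a b (Suc n))\<^sup>2 - a * fib_seq a b (Suc n) * fib_seq a b n - b * (fib_seq a b n)\<^sup>2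
    = (- b) ^ n"
proof (induction n)
  case (Suc n)
  have "(- b) ^ Suc n = - b * ((fib_seq a b (Suc n))\<^sup>2 - a * fib_seq a b (Suc n) * fib_seq a b n
      - b * (fib_seq a b n)\<^sup>2)"
    by (simp only: Suc.IH power_Suc)
  then show ?case by (simp add: power2_eq_square algebra_simps)
qed simp

lemma fib_seq_multiplier_square:
  fixes a b M :: "'a::field poly"
  assumes "[fib_seq a b n = 0] (mod M)"
  shows "[(fib_seq a b (Suc n))\<^sup>2 = (- b) ^ n] (mod M)"
proof -
  let ?F = "fib_seq a b"
  have "(?F (Suc n))\<^sup>2 - (- b) ^ n = ?F n * (a * ?F (Suc n) + b * ?F n)"
    unfolding fib_seq_cassini[of a b n, symmetric] by (simp add: power2_eq_square algebra_simps)
  then show ?thesis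
    using assms by (simp add: cong_iff_dvd_diff cong_0_iff)
qed

lemma fib_seq_shift_by_zero:
  fixes a b M :: "'a::field poly"
  assumes "[fib_seq a b m = 0] (mod M)"
  shows "[fib_seq a b (m + n) = fib_seq a b (Suc m) * fib_seq a b n] (mod M)"
proof (cases n)
  case 0
  then show ?thesis using assms by simp
next
  case (Suc k)
  have "[fib_seq a b (Suc m) * fib_seq a b (Suc k) + b * fib_seq a b m * fib_seq a b k
      = fib_seq a b (Suc m) * fib_seq a b (Suc k) + b * 0 * fib_seq a b k] (mod M)"
    by (intro cong_add cong_mult cong_refl assms)
  then show ?thesis unfolding Suc fib_seq_add by simp
qed

lemma fib_seq_zero_mult:
  fixes a b M :: "'a::field poly"
  assumes "[fib_seq a b m = 0] (mod M)"
  shows "[fib_seq a b (m * k) = 0] (mod M)"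
proof (induction k)
  case (Suc k)
  have "[fib_seq a b (m + m * k) = fib_seq a b (Suc m) * fib_seq a b (m * k)] (mod M)"
    by (rule fib_seq_shift_by_zero[OF assms])
  also have "[fib_seq a b (Suc m) * fib_seq a b (m * k) = fib_seq a b (Suc m) * 0] (mod M)"
    by (intro cong_mult cong_refl Suc.IH)
  finally show ?case by simp
qed simp

text \<open>
  Shifting by the least period fixes the sequence modulo \<open>M\<close>, so subtracting it from a period
  leaves a period or zero.
\<close>
lemma period_mod_dvd:
  fixes a b M :: "'a::field poly"
  assumes "[fib_seq a b n = 0] (mod M)" "[fib_seq a b (Suc n) = 1] (mod M)"
  shows "period_mod a b M dvd n"
  using assms
proof (induction n rule: less_induct)
  case (less n)
  let ?F = "fib_seq a b" and ?p = "period_mod a b M"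
  let ?P = "\<lambda>n. n > 0 \<and> [?F n = 0] (mod M) \<and> [?F (Suc n) = 1] (mod M)"
  show ?case
  proof (cases "n = 0")
    case False
    with less.prems have n: "?P n" by simp
    have p: "?P ?p" unfolding period_mod_def by (rule LeastI[of ?P, OF n])
    have "?p \<le> n" unfolding period_mod_def by (rule Least_le[of ?P, OF n])
    then obtain k where k: "n = ?p + k" using le_Suc_ex by blast
    have shift: "[?F j = ?F (?p + j)] (mod M)" for j
    proof -
      have "[?F (?p + j) = ?F (Suc ?p) * ?F j] (mod M)"
        using p by (intro fib_seq_shift_by_zero) simp
      also have "[?F (Suc ?p) * ?F j = 1 * ?F j] (mod M)"
        using p by (intro cong_mult cong_refl) simp
      finally show ?thesis by (simp add: cong_sym_eq)
    qed
    have "[?F k = 0] (mod M)" "[?F (Suc k) = 1] (mod M)"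
      using cong_trans[OF shift[of k]] cong_trans[OF shift[of "Suc k"]] less.prems
      by (simp_all only: k add_Suc_right)
    moreover have "k < n" using k p by linarith
    ultimately have "?p dvd k" using less.IH by blast
    then show ?thesis unfolding k by (rule dvd_add[OF dvd_refl])
  qed simp
qed

text \<open>
  The positive exponent is a premise because coprimality alone guarantees one only when the
  group of units modulo \<open>M\<close> is torsion, as it is for a finite residue ring.
\<close>
lemma ord_spec_and_dvd:
  fixes x M :: "'a::unique_euclidean_ring"
  assumes "coprime M x" "d > 0" "[x ^ d = 1] (mod M)"
  shows "[x ^ ord M x = 1] (mod M)" "ord M x dvd d"
proof -
  let ?P = "\<lambda>d. d > 0 \<and> [x ^ d = 1] (mod M)" and ?o = "ord M x"
  have o_def: "?o = (LEAST d. ?P d)" using assms(1) by (simp add: ord_def)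
  have P: "?P ?o" unfolding o_def by (rule LeastI[of ?P d]) (use assms in simp)
  then show one: "[x ^ ?o = 1] (mod M)" by simp
  have "x ^ d = (x ^ ?o) ^ (d div ?o) * x ^ (d mod ?o)"
    by (simp flip: power_mult power_add)
  also have "[(x ^ ?o) ^ (d div ?o) * x ^ (d mod ?o) = 1 ^ (d div ?o) * x ^ (d mod ?o)] (mod M)"
    by (intro cong_mult cong_pow cong_refl one)
  finally have "[x ^ (d mod ?o) = 1] (mod M)"
    using assms(3) by (metis cong_sym cong_trans mult_1 power_one)
  moreover have "d mod ?o < (LEAST d. ?P d)" using P mod_less_divisor o_def by metis
  ultimately have "d mod ?o = 0" using not_less_Least[of "d mod ?o" ?P] by simp
  then show "?o dvd d" by (simp add: dvd_eq_mod_eq_0)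
qed

theorem theorem6p1:
  fixes a b M :: "'a::{field,finite} poly"
  assumes "b \<noteq> 0" and "degree M > 0" and "coprime b M"
  shows "beta_mod a b M dvd 2 * ord M (- b) \<and>
    (\<exists>e\<in>{1, 2}. period_mod a b M = e * lcm (rank_mod a b M) (ord M (- b)))"
proof -
  let ?F = "fib_seq a b"
  define r p o' where "r = rank_mod a b M" and "p = period_mod a b M" and "o' = ord M (- b)"
  define L where "L = lcm r o'"
  note rank = rank_mod_spec[OF assms(2,3), of a, folded r_def]
  note period = period_mod_spec[OF assms(2,3), of a, folded p_def]
  have "r dvd p" unfolding r_def p_def by (rule rank_mod_dvd_period_mod[OF assms(2,3)])
  have cop: "coprime M (- b)" using assms(3) by (simp add: coprime_commute coprime_def)

  have "[(- b) ^ p = (?F (Suc p))\<^sup>2] (mod M)"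
    by (rule cong_sym[OF fib_seq_multiplier_square[OF period(2)]])
  also have "[(?F (Suc p))\<^sup>2 = 1\<^sup>2] (mod M)" by (intro cong_pow period(3))
  finally have "[(- b) ^ p = 1] (mod M)" by simp
  note ord = ord_spec_and_dvd[OF cop period(1) this, folded o'_def]
  have "L dvd p" unfolding L_def using \<open>r dvd p\<close> ord(2) by (rule lcm_least)

  have "r dvd L" "o' dvd L" by (simp_all add: L_def)
  have zero: "[?F L = 0] (mod M)"
    using \<open>r dvd L\<close> fib_seq_zero_mult[OF rank(2)] by (auto elim: dvdE)
  have "[?F (L + Suc L) = ?F (Suc L) * ?F (Suc L)] (mod M)"
    by (rule fib_seq_shift_by_zero[OF zero])
  also have "?F (Suc L) * ?F (Suc L) = (?F (Suc L))\<^sup>2" by (simp add: power2_eq_square)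
  also have "[(?F (Suc L))\<^sup>2 = (- b) ^ L] (mod M)" by (rule fib_seq_multiplier_square[OF zero])
  also have "[(- b) ^ L = 1] (mod M)"
  proof -
    obtain k where "L = o' * k" using \<open>o' dvd L\<close> by (rule dvdE)
    then show ?thesis using cong_pow[OF ord(1), of k] by (simp add: power_mult)
  qed
  finally have "[?F (Suc (L * 2)) = 1] (mod M)" by (simp add: mult_2_right)
  then have "p dvd L * 2"
    unfolding p_def by (rule period_mod_dvd[OF fib_seq_zero_mult[OF zero]])

  obtain e where e: "p = L * e" using \<open>L dvd p\<close> by (rule dvdE)
  have "L > 0" using e period(1) by (cases L) auto
  with \<open>p dvd L * 2\<close> have "e dvd 2" unfolding e by simp
  then have "e \<le> 2" by (rule dvd_imp_le) simp
  moreover have "e \<noteq> 0" using e period(1) by auto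
  ultimately have "e \<in> {1, 2}" by auto

  have "L dvd r * o'" by (simp add: L_def)
  have "p dvd r * o' * 2"
    by (rule dvd_trans[OF \<open>p dvd L * 2\<close> mult_dvd_mono[OF \<open>L dvd r * o'\<close> dvd_refl]])
  moreover have "p = r * beta_mod a b M"
    using \<open>r dvd p\<close> by (simp add: beta_mod_def p_def r_def)
  ultimately have "beta_mod a b M dvd 2 * o'"
    using rank(1) by (simp add: mult.assoc mult.commute[of o'])
  then show ?thesis
    using e \<open>e \<in> {1, 2}\<close> unfolding L_def r_def p_def o'_def by (auto simp: mult.commute)
qed

end
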